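(* Let $F,G\in\mathbb{C}^{r\times m}$ be such that the pencil $sF-G$ is singular with $\dim\mathcal{N}_r(sF-G)=0$, let $A,B\in\mathbb{C}^{n\times m}$, $D\in\mathbb{C}^{n\times1}$, and let $k_0\le k_N$ be natural numbers. Consider the boundary value problem of finding $(Y_k)_{k\ge k_0}$ in $\mathbb{C}^{m\times1}$ with $$FY_{k+1}=GY_k\quad(k\ge k_0),\qquad AY_{k_0}+BY_{k_N}=D.$$ Let $J_p\in\mathbb{C}^{p\times p}$, $Q_p\in\mathbb{C}^{m\times p}$ be the matrices associated with the Kronecker canonical form of $sF-G$ (see context), assume $\|J_p\|<1$ for an induced matrix norm $\|\cdot\|$, and put $K=AQ_p+BQ_pJ_p^{k_N-k_0}\in\mathbb{C}^{n\times p}$. Suppose the boundary value problem is non-consistent (has no solution). Then: (a) If $p<n$, $D\notin\operatorname{colspan}K$ and $K$ has full rank, then an optimal solution of the boundary value problem, in the least squares sense, is $$\hat Y_k=Q_pJ_p^{k-k_0}(K^*K)^{-1}K^*D;$$ that is, $\hat Y_k=Q_pJ_p^{k-k_0}\hat C$, where $\hat C=(K^*K)^{-1}K^*D$ minimizes $\|D-KC\|_2^2$ over $C\in\mathbb{C}^{p\times 1}$. (b) If $D\notin\operatorname{colspan}K$ and $K$ is rank deficient, and $E$ is a matrix with $p$ columns such that $K^*K+E^*E$ is invertible and $\|E\|_2=\theta$ with $0<\theta\ll1$, then an optimal solution of the boundary value problem, in the regularized least squares sense, is $$\hat Y_k=Q_pJ_p^{k-k_0}(K^*K+E^*E)^{-1}K^*D;$$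 that is, $\hat Y_k=Q_pJ_p^{k-k_0}\hat C$, where $\hat C=(K^*K+E^*E)^{-1}K^*D$ minimizes $\|D-KC\|_2^2+\|EC\|_2^2$ over $C\in\mathbb{C}^{p\times1}$.
   Context: A pencil $sF-G$ with $F,G\in\mathbb{C}^{r\times m}$ is called singular if $r\ne m$, or $r=m$ and $\det(sF-G)\equiv0$. $\mathcal{N}_r(sF-G)$ is the right null space $\{U(s):(sF-G)U(s)=0\}$ as a vector space over the field of rational functions $\mathbb{C}(s)$; the assumption $\dim\mathcal{N}_r(sF-G)=0$ means that there are no column minimal indices (the degrees of a minimal polynomial basis of $\mathcal{N}_r$). Let $0=\zeta_1=\dots=\zeta_h<\zeta_{h+1}\le\dots\le\zeta_t$ be the row minimal indices (degrees of a minimal polynomial basis of the left null space). Kronecker canonical form in this case: there are non-singular $P\in\mathbb{C}^{r\times r}$, $Q\in\mathbb{C}^{m\times m}$ with $$PFQ=I_p\oplus H_q\oplus F_\zeta\oplus0_{h,0},\qquad PGQ=J_p\oplus I_q\oplus G_\zeta\oplus0_{h,0},$$ where $\oplus$ is the block diagonal sum (blocks may be empty; $0_{h,0}$ stands for $h$ zero rows), $J_p\in\mathbb{C}^{p\times p}$ is the Jordan matrix given by the finite elementary divisors $(s-a_j)^{p_j}$, $\sum_j p_j=p$, $H_q$ is the direct sum of nilpotent Jordan blocks given by the infinite elementary divisors, and $F_\zeta$, $G_\zeta$ are block diagonal with respective blocks $\begin{bmatrix} I_{\zeta_j} \\ 0_{1,\zeta_j} \end{bmatrix}$, $\begin{bmatrix}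 0_{1,\zeta_j} \\ I_{\zeta_j} \end{bmatrix}$, $j=h+1,\dots,t$. Partition $Q=[\,Q_p\ Q_q\ Q_\zeta\,]$ conformally; $Q_p\in\mathbb{C}^{m\times p}$ consists of the first $p$ columns of $Q$. The boundary value problem is consistent if it has at least one solution, and non-consistent otherwise. $\operatorname{colspan}$ is the column space, $(\cdot)^*$ the conjugate transpose, and $\|\cdot\|_2$ the Euclidean norm (for matrices, the norm induced by it). $K$ is rank deficient if its rank is less than $\min(n,p)$. The notation $0<\theta\ll1$ means that $\theta$ is a (small) real number with $0<\theta<1$. By convention $J_p^0=I_p$. *)

theory Defs
  imports
    "HOL-Analysis.L2_Norm"
    "HOL-Computational_Algebra.Polynomial_Factorial"
    "Jordan_Normal_Form.Jordan_Normal_Form"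
    "Jordan_Normal_Form.Schur_Decomposition"
    "Jordan_Normal_Form.Matrix_Kernel"
    "Jordan_Normal_Form.DL_Rank"
begin

definition norm2 :: "complex vec \<Rightarrow> real" where
  "norm2 v = L2_set (\<lambda>i. cmod (v $ i)) {..<dim_vec v}"

definition vec_norm_on :: "nat \<Rightarrow> (complex vec \<Rightarrow> real) \<Rightarrow> bool" where
  "vec_norm_on d \<nu> \<longleftrightarrow>
     (\<forall>v\<in>carrier_vec d. 0 \<le> \<nu> v \<and> (\<nu> v = 0 \<longleftrightarrow> v = 0\<^sub>v d)) \<and>
     (\<forall>v\<in>carrier_vec d. \<forall>c. \<nu> (c \<cdot>\<^sub>v v) = cmod c * \<nu> v) \<and>
     (\<forall>v\<in>carrier_vec d. \<forall>w\<in>carrier_vec d. \<nu> (v + w) \<le> \<nu> v + \<nu> w)"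

text \<open>The supremum runs over the closed unit ball rather than the unit sphere, so that
  a matrix without columns has norm 0 (there the sphere is empty).\<close>

definition induced_norm ::
    "(complex vec \<Rightarrow> real) \<Rightarrow> (complex vec \<Rightarrow> real) \<Rightarrow> complex mat \<Rightarrow> real" where
  "induced_norm \<nu> \<mu> M = (SUP v \<in> {v \<in> carrier_vec (dim_col M). \<nu> v \<le> 1}. \<mu> (M *\<^sub>v v))"

text \<open>The value is meaningful only for invertible matrices.\<close>

definition mat_inv :: "complex mat \<Rightarrow> complex mat" where
  "mat_inv M = the (mat_inverse M)"

definition pencil :: "complex mat \<Rightarrow> complex mat \<Rightarrow> complex poly mat" where
  "pencil F G = mat (dim_row F) (dim_col F) (\<lambda>(i, j). [:- (G $$ (i, j)), F $$ (i, j):])"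

definition singular_pencil :: "complex mat \<Rightarrow> complex mat \<Rightarrow> bool" where
  "singular_pencil F G \<longleftrightarrow>
     dim_row F \<noteq> dim_col F \<or> dim_row F = dim_col F \<and> det (pencil F G) = 0"

text \<open>The field \<open>complex poly fract\<close> is that of the rational functions in \<open>s\<close>; over it, not over the
  polynomials, the null space is a vector space.\<close>

definition right_null_dim :: "complex mat \<Rightarrow> complex mat \<Rightarrow> nat" where
  "right_null_dim F G = kernel_dim (map_mat to_fract (pencil F G) :: complex poly fract mat)"

text \<open>The Kronecker canonical form of a pencil without column minimal indices. The data are
  the list \<open>js\<close> of the pairs \<open>(p\<^sub>j, a\<^sub>j)\<close> given by the finite elementary divisors
  \<open>(s - a\<^sub>j) ^ p\<^sub>j\<close>, the list \<open>ns\<close> of the degrees of the infinite elementary divisors, the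
  list \<open>zs\<close> of the nonzero row minimal indices, and the number \<open>h\<close> of zero row minimal
  indices. By uniqueness of the canonical form the two equations determine \<open>zs\<close> and \<open>h\<close>, and
  determine \<open>js\<close> and \<open>ns\<close> up to order.\<close>

definition kronecker_form ::
    "complex mat \<Rightarrow> complex mat \<Rightarrow> complex mat \<Rightarrow> complex mat \<Rightarrow>
     (nat \<times> complex) list \<Rightarrow> nat list \<Rightarrow> nat list \<Rightarrow> nat \<Rightarrow> bool" where
  "kronecker_form F G P Q js ns zs h \<longleftrightarrow>
     P \<in> carrier_mat (dim_row F) (dim_row F) \<and> invertible_mat P \<and>
     Q \<in> carrier_mat (dim_col F) (dim_col F) \<and> invertible_mat Q \<and>
     0 \<notin> fst ` set js \<and> 0 \<notin> set ns \<and> 0 \<notin> set zs \<and> sorted zs \<and>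
     P * F * Q = diag_block_mat
       [1\<^sub>m (sum_list (map fst js)),
        jordan_matrix (map (\<lambda>l. (l, 0)) ns),
        diag_block_mat (map (\<lambda>z. 1\<^sub>m z @\<^sub>r 0\<^sub>m 1 z) zs),
        0\<^sub>m h 0] \<and>
     P * G * Q = diag_block_mat
       [jordan_matrix js,
        1\<^sub>m (sum_list ns),
        diag_block_mat (map (\<lambda>z. 0\<^sub>m 1 z @\<^sub>r 1\<^sub>m z) zs),
        0\<^sub>m h 0]"

definition first_cols :: "nat \<Rightarrow> complex mat \<Rightarrow> complex mat" where
  "first_cols p Q = mat (dim_row Q) p (\<lambda>ij. Q $$ ij)"

text \<open>Only the values \<open>Y k\<close> with \<open>k \<ge> k0\<close> are relevant.\<close>

definition diff_solution ::
    "complex mat \<Rightarrow> complex mat \<Rightarrow> nat \<Rightarrow> (nat \<Rightarrow> complex vec) \<Rightarrow> bool" where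
  "diff_solution F G k0 Y \<longleftrightarrow>
     (\<forall>k\<ge>k0. Y k \<in> carrier_vec (dim_col F) \<and> F *\<^sub>v Y (Suc k) = G *\<^sub>v Y k)"

definition bvp_solution ::
    "complex mat \<Rightarrow> complex mat \<Rightarrow> complex mat \<Rightarrow> complex mat \<Rightarrow> complex vec \<Rightarrow>
     nat \<Rightarrow> nat \<Rightarrow> (nat \<Rightarrow> complex vec) \<Rightarrow> bool" where
  "bvp_solution F G A B D k0 kN Y \<longleftrightarrow>
     diff_solution F G k0 Y \<and> A *\<^sub>v Y k0 + B *\<^sub>v Y kN = D"

definition bvp_consistent ::
    "complex mat \<Rightarrow> complex mat \<Rightarrow> complex mat \<Rightarrow> complex mat \<Rightarrow> complex vec \<Rightarrow>
     nat \<Rightarrow> nat \<Rightarrow> bool" where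
  "bvp_consistent F G A B D k0 kN \<longleftrightarrow> (\<exists>Y. bvp_solution F G A B D k0 kN Y)"

definition boundary_residual ::
    "complex mat \<Rightarrow> complex mat \<Rightarrow> complex vec \<Rightarrow> nat \<Rightarrow> nat \<Rightarrow> (nat \<Rightarrow> complex vec) \<Rightarrow> real" where
  "boundary_residual A B D k0 kN Y = norm2 (D - (A *\<^sub>v Y k0 + B *\<^sub>v Y kN))"

definition least_squares_solution ::
    "complex mat \<Rightarrow> complex mat \<Rightarrow> complex mat \<Rightarrow> complex mat \<Rightarrow> complex vec \<Rightarrow>
     nat \<Rightarrow> nat \<Rightarrow> (nat \<Rightarrow> complex vec) \<Rightarrow> bool" where
  "least_squares_solution F G A B D k0 kN Y \<longleftrightarrow>
     is_arg_min (\<lambda>Y. (boundary_residual A B D k0 kN Y)\<^sup>2) (diff_solution F G k0) Y"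

text \<open>The penalty is imposed on the coefficient vector \<open>C\<close> in the representation
  \<open>Y\<^sub>k = Q\<^sub>p J\<^sub>p ^ (k - k\<^sub>0) C\<close> of a solution of the difference equation, so the minimization
  runs over solutions together with their coefficient vectors.\<close>

definition regularized_least_squares_solution ::
    "complex mat \<Rightarrow> complex mat \<Rightarrow> complex mat \<Rightarrow> complex mat \<Rightarrow> complex vec \<Rightarrow>
     nat \<Rightarrow> nat \<Rightarrow> complex mat \<Rightarrow> complex mat \<Rightarrow> complex mat \<Rightarrow> (nat \<Rightarrow> complex vec) \<Rightarrow> bool" where
  "regularized_least_squares_solution F G A B D k0 kN Qp Jp E Y \<longleftrightarrow>
     (\<exists>C. is_arg_min
       (\<lambda>(Y, C). (boundary_residual A B D k0 kN Y)\<^sup>2 + (norm2 (E *\<^sub>v C))\<^sup>2)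
       (\<lambda>(Y, C). diff_solution F G k0 Y \<and> C \<in> carrier_vec (dim_col Qp) \<and>
          (\<forall>k\<ge>k0. Y k = Qp * Jp ^\<^sub>m (k - k0) *\<^sub>v C))
       (Y, C))"

end

theory Submission
  imports Defs
begin

text \<open>The theorem reduces a minimization over sequences to a finite-dimensional linear least squares
  problem. In the coordinates of the Kronecker canonical form the equation \<open>F Y\<^sub>k\<^sub>+\<^sub>1 = G Y\<^sub>k\<close> splits
  into one equation for each diagonal block. The block \<open>(I\<^sub>p, J\<^sub>p)\<close> reads \<open>x\<^sub>k\<^sub>+\<^sub>1 = J\<^sub>p x\<^sub>k\<close> and leaves the
  initial vector \<open>C\<close> free. All other blocks force their coordinates to vanish: both for a nilpotent
  Jordan block and for the block of a row minimal index the rows say that entry \<open>i\<close> at time \<open>k\<close>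
  equals entry \<open>i + 1\<close> at time \<open>k + 1\<close>, and that the last entry is zero at all times, so all
  entries are zero from the last one upwards. Hence the solutions are precisely the sequences
  \<open>Y\<^sub>k = Q\<^sub>p J\<^sub>p ^ (k - k\<^sub>0) C\<close> (lemma \<open>diff_solution_iff\<close>).

  For such a sequence the boundary residual is \<open>D - K C\<close>, so the optimal solutions come from the
  minimizers of \<open>\<parallel>D - K C\<parallel>\<^sup>2 + \<parallel>E C\<parallel>\<^sup>2\<close>, with no penalty \<open>E\<close> in the first case. The objective is a
  convex quadratic, and a solution of the normal equations \<open>(K\<^sup>* K + E\<^sup>* E) C = K\<^sup>* D\<close> minimizes it:
  the linear terms of its expansion around such a \<open>C\<close> cancel and squares of norms remain
  (lemma \<open>normal_equations_minimize\<close>). Without a penalty the normal equations are solvable because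
  full column rank of \<open>K\<close> makes \<open>K\<^sup>* K\<close> injective (lemma \<open>gram_matrix_invertible\<close>).\<close>

section \<open>Least squares over the complex numbers\<close>

lemma norm2_sq: "complex_of_real ((norm2 v)\<^sup>2) = v \<bullet>c v"
proof -
  have "(norm2 v)\<^sup>2 = (\<Sum>i<dim_vec v. (cmod (v $ i))\<^sup>2)"
    by (simp add: norm2_def L2_set_def sum_nonneg)
  then show ?thesis
    by (simp add: scalar_prod_def lessThan_atLeast0 flip: complex_norm_square del: of_real_power)
qed

lemma cscalar_prod_swap:
  fixes u v :: "complex vec"
  assumes "u \<in> carrier_vec d" "v \<in> carrier_vec d"
  shows "v \<bullet>c u = cnj (u \<bullet>c v)"
  using assms by (simp add: scalar_prod_def mult.commute)

lemma norm2_add_sq: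
  assumes u: "u \<in> carrier_vec d" and v: "v \<in> carrier_vec d"
  shows "(norm2 (u + v))\<^sup>2 = (norm2 u)\<^sup>2 + (norm2 v)\<^sup>2 + 2 * Re (v \<bullet>c u)"
proof -
  have "(u + v) \<bullet>c (u + v) = u \<bullet>c u + v \<bullet>c v + (v \<bullet>c u + u \<bullet>c v)"
    using u v by (simp add: conjugate_add_vec[OF u v] add_scalar_prod_distrib[of _ d]
        scalar_prod_add_distrib[of _ d])
  then have "Re ((u + v) \<bullet>c (u + v)) = Re (u \<bullet>c u) + Re (v \<bullet>c v) + 2 * Re (v \<bullet>c u)"
    by (simp add: cscalar_prod_swap[OF v u])
  then show ?thesis
    by (simp flip: norm2_sq)
qed

lemma mat_adjoint_carrier: "M \<in> carrier_mat r c \<Longrightarrow> mat_adjoint M \<in> carrier_mat c r"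
  by (auto simp: mat_adjoint_def)

lemma mat_adjoint_index:
  fixes M :: "complex mat"
  assumes "M \<in> carrier_mat r c" "i < c" "j < r"
  shows "mat_adjoint M $$ (i, j) = cnj (M $$ (j, i))"
  using assms by (simp add: mat_adjoint_def mat_of_rows_index)

lemma cscalar_prod_adjoint:
  fixes M :: "complex mat"
  assumes M: "M \<in> carrier_mat r c" and x: "x \<in> carrier_vec c" and y: "y \<in> carrier_vec r"
  shows "(M *\<^sub>v x) \<bullet>c y = x \<bullet>c (mat_adjoint M *\<^sub>v y)"
proof -
  note A = mat_adjoint_carrier[OF M]
  have "(M *\<^sub>v x) \<bullet>c y = (\<Sum>i<r. \<Sum>j<c. M $$ (i, j) * x $ j * cnj (y $ i))"
    using M x y by (simp add: scalar_prod_def sum_distrib_right lessThan_atLeast0)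
  also have "\<dots> = (\<Sum>j<c. \<Sum>i<r. M $$ (i, j) * x $ j * cnj (y $ i))"
    by (rule sum.swap)
  also have "\<dots> = x \<bullet>c (mat_adjoint M *\<^sub>v y)"
    using M A x y by (simp add: scalar_prod_def sum_distrib_left lessThan_atLeast0
        mat_adjoint_index[OF M] mult_ac)
  finally show ?thesis .
qed

text \<open>Write \<open>u = D - K C\<close>. For a displacement \<open>d\<close> from \<open>C\<close> the objective changes by
  \<open>\<parallel>K d\<parallel>\<^sup>2 + \<parallel>E d\<parallel>\<^sup>2 + 2 Re \<langle>d, E\<^sup>* E C - K\<^sup>* u\<rangle>\<close>, and the normal equations say that the second
  argument of the inner product is zero.\<close>

lemma normal_equations_minimize:
  assumes K: "K \<in> carrier_mat n p" and E: "E \<in> carrier_mat l p" and D: "D \<in> carrier_vec n"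
    and C: "C \<in> carrier_vec p"
    and normal: "(mat_adjoint K * K + mat_adjoint E * E) *\<^sub>v C = mat_adjoint K *\<^sub>v D"
  shows "is_arg_min (\<lambda>C. (norm2 (D - K *\<^sub>v C))\<^sup>2 + (norm2 (E *\<^sub>v C))\<^sup>2)
    (\<lambda>C. C \<in> carrier_vec p) C"
proof -
  note K' = mat_adjoint_carrier[OF K] and E' = mat_adjoint_carrier[OF E]
  define u where "u = D - K *\<^sub>v C"
  have u: "u \<in> carrier_vec n" and EC: "E *\<^sub>v C \<in> carrier_vec l" and KC: "K *\<^sub>v C \<in> carrier_vec n"
    using K E C D by (auto simp: u_def)
  have "mat_adjoint K *\<^sub>v (K *\<^sub>v C) + mat_adjoint E *\<^sub>v (E *\<^sub>v C) = mat_adjoint K *\<^sub>v D"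
    using normal K E K' E' C
    by (simp add: add_mult_distrib_mat_vec[of _ p p] assoc_mult_mat_vec[of _ p _ _ p])
  moreover have "mat_adjoint K *\<^sub>v u = mat_adjoint K *\<^sub>v D - mat_adjoint K *\<^sub>v (K *\<^sub>v C)"
    unfolding u_def by (rule mult_minus_distrib_mat_vec[OF K' D KC])
  moreover have "mat_adjoint E *\<^sub>v (E *\<^sub>v C)
      = (mat_adjoint K *\<^sub>v (K *\<^sub>v C) + mat_adjoint E *\<^sub>v (E *\<^sub>v C)) - mat_adjoint K *\<^sub>v (K *\<^sub>v C)"
    using K' E' by (intro eq_vecI) auto
  ultimately have grad: "mat_adjoint E *\<^sub>v (E *\<^sub>v C) = mat_adjoint K *\<^sub>v u"
    by simp
  have "(norm2 u)\<^sup>2 + (norm2 (E *\<^sub>v C))\<^sup>2 \<le> (norm2 (D - K *\<^sub>v X))\<^sup>2 + (norm2 (E *\<^sub>v X))\<^sup>2"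
    if X: "X \<in> carrier_vec p" for X
  proof -
    define d where "d = X - C"
    have d: "d \<in> carrier_vec p" and X_eq: "X = C + d"
      using X C by (auto simp: d_def)
    have Kd: "K *\<^sub>v d \<in> carrier_vec n" and Ed: "E *\<^sub>v d \<in> carrier_vec l"
      using K E d by auto
    have "D - K *\<^sub>v X = u + - (K *\<^sub>v d)"
      unfolding X_eq u_def mult_add_distrib_mat_vec[OF K C d]
      using D KC Kd by (intro eq_vecI) auto
    moreover have "(norm2 (- (K *\<^sub>v d)))\<^sup>2 = (norm2 (K *\<^sub>v d))\<^sup>2"
      by (simp add: norm2_def L2_set_def)
    moreover have "(- (K *\<^sub>v d)) \<bullet>c u = - (d \<bullet>c (mat_adjoint K *\<^sub>v u))"
      unfolding cscalar_prod_adjoint[OF K d u, symmetric]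
      by (rule uminus_scalar_prod[OF Kd carrier_vec_conjugate[OF u], symmetric])
    ultimately have "(norm2 (D - K *\<^sub>v X))\<^sup>2
        = (norm2 u)\<^sup>2 + (norm2 (K *\<^sub>v d))\<^sup>2 - 2 * Re (d \<bullet>c (mat_adjoint K *\<^sub>v u))"
      using norm2_add_sq[OF u, of "- (K *\<^sub>v d)"] Kd by simp
    moreover have "(norm2 (E *\<^sub>v X))\<^sup>2 = (norm2 (E *\<^sub>v C))\<^sup>2 + (norm2 (E *\<^sub>v d))\<^sup>2
        + 2 * Re (d \<bullet>c (mat_adjoint K *\<^sub>v u))"
      unfolding X_eq mult_add_distrib_mat_vec[OF E C d] norm2_add_sq[OF EC Ed]
        cscalar_prod_adjoint[OF E d EC] grad ..
    ultimately show ?thesis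
      by simp
  qed
  then show ?thesis
    using C by (simp add: is_arg_min_linorder u_def)
qed

text \<open>A penalty matrix without rows contributes nothing, neither to the objective nor to the normal
  equations.\<close>

lemma normal_equations_minimize_unpenalized:
  assumes K: "K \<in> carrier_mat n p" and D: "D \<in> carrier_vec n" and C: "C \<in> carrier_vec p"
    and normal: "mat_adjoint K * K *\<^sub>v C = mat_adjoint K *\<^sub>v D"
  shows "is_arg_min (\<lambda>C. (norm2 (D - K *\<^sub>v C))\<^sup>2) (\<lambda>C. C \<in> carrier_vec p) C"
proof -
  let ?E = "0\<^sub>m 0 p :: complex mat"
  have "mat_adjoint ?E * ?E = 0\<^sub>m p p"
    by (rule eq_matI) (auto simp: mat_adjoint_def)
  then have "(mat_adjoint K * K + mat_adjoint ?E * ?E) *\<^sub>v C = mat_adjoint K *\<^sub>v D"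
    using normal mult_carrier_mat[OF mat_adjoint_carrier[OF K] K] by simp
  from normal_equations_minimize[OF K zero_carrier_mat[of 0 p] D C this] show ?thesis
    by (simp add: norm2_def)
qed

lemma invertible_mat_obtain_inverse:
  fixes M :: "'a::comm_ring_1 mat"
  assumes M: "M \<in> carrier_mat d d" and inv: "invertible_mat M"
  obtains B where "B \<in> carrier_mat d d" "M * B = 1\<^sub>m d" "B * M = 1\<^sub>m d"
proof -
  from inv M obtain B where B: "M * B = 1\<^sub>m d" "B * M = 1\<^sub>m (dim_row B)"
    unfolding invertible_mat_def inverts_mat_def by auto
  have "dim_col (M * B) = d" "dim_col (B * M) = dim_row B"
    unfolding B by simp_all
  then have "dim_col B = d" "dim_row B = d"
    using M by simp_all
  with B show ?thesis
    by (intro that[of B]) auto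
qed

lemma mat_inv_inverse:
  assumes M: "M \<in> carrier_mat d d" and inv: "invertible_mat M"
  shows "mat_inv M \<in> carrier_mat d d" "M * mat_inv M = 1\<^sub>m d"
proof -
  obtain B where B: "B \<in> carrier_mat d d" "M * B = 1\<^sub>m d" "B * M = 1\<^sub>m d"
    using invertible_mat_obtain_inverse[OF assms] .
  then have "M \<in> Units (ring_mat TYPE(complex) d ())"
    using M by (auto simp: Units_def ring_mat_def)
  then obtain X where "mat_inverse M = Some X"
    using mat_inverse(1)[OF M, where b = "()"] by (cases "mat_inverse M") auto
  with mat_inverse(2)[OF M this] show "mat_inv M \<in> carrier_mat d d" "M * mat_inv M = 1\<^sub>m d"
    by (auto simp: mat_inv_def)
qed

lemma mat_inv_solves:
  assumes M: "M \<in> carrier_mat d d" and inv: "invertible_mat M"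
    and R: "R \<in> carrier_mat d e" and v: "v \<in> carrier_vec e"
  shows "mat_inv M * R *\<^sub>v v \<in> carrier_vec d" "M *\<^sub>v (mat_inv M * R *\<^sub>v v) = R *\<^sub>v v"
proof -
  note I = mat_inv_inverse[OF M inv]
  show "mat_inv M * R *\<^sub>v v \<in> carrier_vec d"
    using I R v by auto
  have "M *\<^sub>v (mat_inv M * R *\<^sub>v v) = (M * mat_inv M) *\<^sub>v (R *\<^sub>v v)"
    using M I(1) R v by (simp add: assoc_mult_mat_vec[of _ d _ _ d] assoc_mult_mat_vec[of _ d _ _ e])
  then show "M *\<^sub>v (mat_inv M * R *\<^sub>v v) = R *\<^sub>v v"
    using I(2) R v by simp
qed

lemma invertible_mat_if_trivial_kernel:
  fixes M :: "'a::field mat"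
  assumes M: "M \<in> carrier_mat d d"
    and ker: "\<And>v. v \<in> carrier_vec d \<Longrightarrow> M *\<^sub>v v = 0\<^sub>v d \<Longrightarrow> v = 0\<^sub>v d"
  shows "invertible_mat M"
proof -
  have "det M \<noteq> 0"
    using det_0_iff_vec_prod_zero[OF M] ker by blast
  then have "M \<in> Units (ring_mat TYPE('a) d ())"
    by (rule det_non_zero_imp_unit[OF M])
  then show ?thesis
    using M by (auto simp: Units_def ring_mat_def invertible_mat_def inverts_mat_def)
qed

text \<open>The rank is computed from the \<^emph>\<open>set\<close> of columns, so a repeated column costs rank.\<close>

lemma (in vec_space) full_rank_distinct_cols:
  assumes A: "A \<in> carrier_mat n nc" and rank: "rank A = nc"
  shows "distinct (cols A)"
proof -
  let ?P = "\<lambda>T. T \<subseteq> set (cols A) \<and> lin_indpt T"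
  have "?P {}"
    using finite_lin_indpt2[of "{}"] by auto
  then obtain S where S: "maximal S ?P"
    using maximal_exists_superset[of "set (cols A)" ?P "{}"] by auto
  then have "card S \<le> card (set (cols A))"
    by (simp add: card_mono maximal_def)
  then have "length (cols A) \<le> card (set (cols A))"
    using rank_card_indpt[OF A S] rank A by simp
  then show ?thesis
    by (intro card_distinct antisym card_length)
qed

text \<open>If \<open>K\<^sup>* K v = 0\<close>, then \<open>\<parallel>K v\<parallel>\<^sup>2 = \<langle>v, K\<^sup>* K v\<rangle> = 0\<close>, and the columns of \<open>K\<close> are independent.\<close>

lemma gram_matrix_invertible:
  fixes K :: "complex mat"
  assumes K: "K \<in> carrier_mat n p" and rank: "vec_space.rank n K = p"
  shows "invertible_mat (mat_adjoint K * K)"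
proof (rule invertible_mat_if_trivial_kernel)
  note K' = mat_adjoint_carrier[OF K]
  show "mat_adjoint K * K \<in> carrier_mat p p"
    using K K' by simp
  fix v :: "complex vec"
  assume v: "v \<in> carrier_vec p" and zero: "mat_adjoint K * K *\<^sub>v v = 0\<^sub>v p"
  have Kv: "K *\<^sub>v v \<in> carrier_vec n"
    using K v by simp
  have "mat_adjoint K *\<^sub>v (K *\<^sub>v v) = 0\<^sub>v p"
    using zero K K' v by (simp add: assoc_mult_mat_vec[of _ p _ _ p])
  then have "(K *\<^sub>v v) \<bullet>c (K *\<^sub>v v) = 0"
    using cscalar_prod_adjoint[OF K v Kv] v by simp
  then have Kv0: "K *\<^sub>v v = 0\<^sub>v n"
    using conjugate_square_eq_0_vec[OF Kv] by simp
  interpret V: vec_space "TYPE(complex)" n .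
  have dist: "distinct (cols K)"
    by (rule V.full_rank_distinct_cols[OF K rank])
  show "v = 0\<^sub>v p"
    using V.lin_depI[OF K v _ Kv0 dist] V.full_rank_lin_indpt[OF K rank dist] by blast
qed

section \<open>Pencils whose difference equation has only the zero solution\<close>

text \<open>Every diagonal block of the canonical form is inert, apart from the one of the finite elementary
  divisors. The property is stated for solution sequences, not for the shape of the matrices, because
  in this form it passes to block diagonal sums.\<close>

definition inert_pencil :: "'a::semiring_1 mat \<Rightarrow> 'a mat \<Rightarrow> bool" where
  "inert_pencil M N \<longleftrightarrow>
     dim_row N = dim_row M \<and> dim_col N = dim_col M \<and>
     (\<forall>w. (\<forall>k. w k \<in> carrier_vec (dim_col M)) \<and> (\<forall>k. M *\<^sub>v w (Suc k) = N *\<^sub>v w k) \<longrightarrow>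
       (\<forall>k. w k = 0\<^sub>v (dim_col M)))"

text \<open>Row \<open>\<rho> i\<close> of the equation states that entry \<open>i\<close> of \<open>w\<^sub>k\<close> is entry \<open>i + 1\<close> of \<open>w\<^sub>k\<^sub>+\<^sub>1\<close>, or zero
  if there is no such entry. A nilpotent Jordan block satisfies this with \<open>\<rho> i = i\<close>. The block of a
  row minimal index satisfies it with \<open>\<rho> i = i + 1\<close>.\<close>

lemma inert_pencil_shift:
  fixes M N :: "'a::semiring_1 mat"
  assumes M: "M \<in> carrier_mat r c" and N: "N \<in> carrier_mat r c"
    and \<rho>: "\<And>i. i < c \<Longrightarrow> \<rho> i < r"
    and ent: "\<And>i j. i < c \<Longrightarrow> j < c \<Longrightarrow> N $$ (\<rho> i, j) = (if j = i then 1 else 0)"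
      "\<And>i j. i < c \<Longrightarrow> j < c \<Longrightarrow> M $$ (\<rho> i, j) = (if j = Suc i then 1 else 0)"
  shows "inert_pencil M N"
  unfolding inert_pencil_def
proof (intro conjI allI impI)
  show "dim_row N = dim_row M" "dim_col N = dim_col M"
    using M N by auto
  fix w :: "nat \<Rightarrow> 'a vec" and k
  assume "(\<forall>k. w k \<in> carrier_vec (dim_col M)) \<and> (\<forall>k. M *\<^sub>v w (Suc k) = N *\<^sub>v w k)"
  then have w: "\<And>k. dim_vec (w k) = c" and step: "\<And>k. M *\<^sub>v w (Suc k) = N *\<^sub>v w k"
    using M by auto
  have shift: "w k $ i = (if Suc i < c then w (Suc k) $ Suc i else 0)" if i: "i < c" for i k
  proof -
    have "(N *\<^sub>v w k) $ \<rho> i = w k $ i"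
      using N \<rho>[OF i] i w by (simp add: scalar_prod_def ent if_distrib[of "\<lambda>x. x * _"] cong: if_cong)
    moreover have "(M *\<^sub>v w (Suc k)) $ \<rho> i = (if Suc i < c then w (Suc k) $ Suc i else 0)"
      using M \<rho>[OF i] i w by (simp add: scalar_prod_def ent if_distrib[of "\<lambda>x. x * _"] cong: if_cong)
    ultimately show ?thesis
      using step by simp
  qed
  (* Induction from the last entry backwards, for all times at once: each step looks one step
     ahead in time. *)
  have "w k $ i = 0" if "i < c" for i k
    using that
  proof (induction "c - i" arbitrary: i k rule: less_induct)
    case less
    then show ?case
      using shift[of i k] by (cases "Suc i < c") auto
  qed
  then show "w k = 0\<^sub>v (dim_col M)"
    using M w by (intro eq_vecI) auto
qed

lemma block_diag_mult_vec:
  fixes A D :: "'a::comm_semiring_1 mat"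
  assumes "x \<in> carrier_vec (dim_col A)" "y \<in> carrier_vec (dim_col D)"
    and "a = dim_row A" "b = dim_col D" "c = dim_row D" "d = dim_col A"
  shows "four_block_mat A (0\<^sub>m a b) (0\<^sub>m c d) D *\<^sub>v (x @\<^sub>v y) = (A *\<^sub>v x) @\<^sub>v (D *\<^sub>v y)"
  using assms
  by (subst four_block_mat_mult_vec[of _ "dim_row A" "dim_col A" _ "dim_col D" _ "dim_row D"]) auto

lemma block_diag_solution_split:
  fixes M M' N N' :: "'a::comm_semiring_1 mat"
  assumes dims: "dim_row N = dim_row M" "dim_col N = dim_col M"
      "dim_row N' = dim_row M'" "dim_col N' = dim_col M'"
    and w: "\<And>k. w k \<in> carrier_vec (dim_col M + dim_col M')"
    and step: "\<And>k. four_block_mat M (0\<^sub>m (dim_row M) (dim_col M')) (0\<^sub>m (dim_row M') (dim_col M)) M'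
        *\<^sub>v w (Suc k) =
      four_block_mat N (0\<^sub>m (dim_row M) (dim_col M')) (0\<^sub>m (dim_row M') (dim_col M)) N' *\<^sub>v w k"
  obtains x y where "\<And>k. w k = x k @\<^sub>v y k"
    "\<And>k. x k \<in> carrier_vec (dim_col M)" "\<And>k. y k \<in> carrier_vec (dim_col M')"
    "\<And>k. M *\<^sub>v x (Suc k) = N *\<^sub>v x k" "\<And>k. M' *\<^sub>v y (Suc k) = N' *\<^sub>v y k"
proof -
  define x where "x k = vec_first (w k) (dim_col M)" for k
  define y where "y k = vec_last (w k) (dim_col M')" for k
  have xy: "w k = x k @\<^sub>v y k" "x k \<in> carrier_vec (dim_col M)" "y k \<in> carrier_vec (dim_col M')" for k
    using w[of k] by (simp_all add: x_def y_def)
  have blocks: "(M *\<^sub>v x (Suc k)) @\<^sub>v (M' *\<^sub>v y (Suc k)) = (N *\<^sub>v x k) @\<^sub>v (N' *\<^sub>v y k)" for k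
    using step[of k] unfolding xy(1)
    by (subst (asm) (1 2) block_diag_mult_vec) (simp_all only: xy dims)
  have eqs: "M *\<^sub>v x (Suc k) = N *\<^sub>v x k \<and> M' *\<^sub>v y (Suc k) = N' *\<^sub>v y k" for k
  proof -
    have 1: "M *\<^sub>v x (Suc k) \<in> carrier_vec (dim_row M)"
      by (intro carrier_vecI) simp
    have 2: "N *\<^sub>v x k \<in> carrier_vec (dim_row M)"
      by (intro carrier_vecI) (simp add: dims)
    show ?thesis
      using append_vec_eq[OF 1 2, THEN iffD1, OF blocks] .
  qed
  show ?thesis
    using that[of x y, OF xy eqs[THEN conjunct1] eqs[THEN conjunct2]] .
qed

lemma inert_pencil_block_diag:
  fixes M M' N N' :: "'a::comm_semiring_1 mat"
  assumes "inert_pencil M N" "inert_pencil M' N'"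
  shows "inert_pencil
    (four_block_mat M (0\<^sub>m (dim_row M) (dim_col M')) (0\<^sub>m (dim_row M') (dim_col M)) M')
    (four_block_mat N (0\<^sub>m (dim_row N) (dim_col N')) (0\<^sub>m (dim_row N') (dim_col N)) N')"
proof -
  have dims: "dim_row N = dim_row M" "dim_col N = dim_col M"
      "dim_row N' = dim_row M'" "dim_col N' = dim_col M'"
    using assms by (auto simp: inert_pencil_def)
  have "w k = 0\<^sub>v (dim_col M + dim_col M')"
    if w: "\<And>k. w k \<in> carrier_vec (dim_col M + dim_col M')"
      and step: "\<And>k. four_block_mat M (0\<^sub>m (dim_row M) (dim_col M')) (0\<^sub>m (dim_row M') (dim_col M)) M'
        *\<^sub>v w (Suc k) =
      four_block_mat N (0\<^sub>m (dim_row M) (dim_col M')) (0\<^sub>m (dim_row M') (dim_col M)) N' *\<^sub>v w k"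
    for w k
  proof -
    obtain x y where xy: "\<And>k. w k = x k @\<^sub>v y k"
      "\<And>k. x k \<in> carrier_vec (dim_col M)" "\<And>k. y k \<in> carrier_vec (dim_col M')"
      "\<And>k. M *\<^sub>v x (Suc k) = N *\<^sub>v x k" "\<And>k. M' *\<^sub>v y (Suc k) = N' *\<^sub>v y k"
      using block_diag_solution_split[where w = w, OF dims w step] by blast
    then have "x k = 0\<^sub>v (dim_col M)" "y k = 0\<^sub>v (dim_col M')"
      using assms unfolding inert_pencil_def by blast+
    then show ?thesis
      using xy(1)[of k] by auto
  qed
  then show ?thesis
    using dims unfolding inert_pencil_def by simp
qed

lemma inert_pencil_diag_block_mat:
  fixes Ms Ns :: "'a::comm_semiring_1 mat list"
  assumes "list_all2 inert_pencil Ms Ns"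
  shows "inert_pencil (diag_block_mat Ms) (diag_block_mat Ns)"
  using assms
proof (induction rule: list_all2_induct)
  case Nil
  then show ?case
    using inert_pencil_shift[of "0\<^sub>m 0 0" 0 0 "0\<^sub>m 0 0"] by simp
next
  case (Cons M Ms N Ns)
  then show ?case
    using inert_pencil_block_diag[OF Cons.hyps(1) Cons.IH] by (simp add: Let_def)
qed

lemma diag_block_mat_one_mats: "diag_block_mat (map 1\<^sub>m ns) = 1\<^sub>m (sum_list ns)"
  by (induction ns) (auto simp: Let_def)

lemma inert_pencil_infinite_part:
  "inert_pencil (jordan_matrix (map (\<lambda>l. (l, 0)) ns) :: 'a::comm_semiring_1 mat) (1\<^sub>m (sum_list ns))"
proof -
  have "inert_pencil (jordan_block l 0 :: 'a mat) (1\<^sub>m l)" for l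
    by (rule inert_pencil_shift[where \<rho> = id and r = l and c = l]) (auto simp: eq_commute)
  then show ?thesis
    unfolding jordan_matrix_def diag_block_mat_one_mats[symmetric]
    by (intro inert_pencil_diag_block_mat) (auto simp: list_all2_conv_all_nth)
qed

lemma inert_pencil_row_minimal_part:
  "inert_pencil (diag_block_mat (map (\<lambda>z. 1\<^sub>m z @\<^sub>r 0\<^sub>m 1 z) zs) :: 'a::comm_semiring_1 mat)
    (diag_block_mat (map (\<lambda>z. 0\<^sub>m 1 z @\<^sub>r 1\<^sub>m z) zs))"
proof -
  have "inert_pencil (1\<^sub>m z @\<^sub>r 0\<^sub>m 1 z :: 'a mat) (0\<^sub>m 1 z @\<^sub>r 1\<^sub>m z)" for z
    by (rule inert_pencil_shift[where \<rho> = Suc and r = "Suc z" and c = z])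
      (auto simp: append_rows_def)
  then show ?thesis
    by (intro inert_pencil_diag_block_mat) (auto simp: list_all2_conv_all_nth)
qed

lemma inert_pencil_zero_rows: "inert_pencil (0\<^sub>m h 0) (0\<^sub>m h 0)"
  by (rule inert_pencil_shift[where r = h and c = 0]) auto

section \<open>The solutions of the difference equation\<close>

text \<open>The infinite elementary divisors and the row minimal indices enter the solution of the
  difference equation in the same way, so their blocks are merged into one inert pencil.\<close>

lemma kronecker_form_split:
  assumes "kronecker_form F G P Q js ns zs h"
  obtains H N where "inert_pencil H N"
    "P * F * Q = four_block_mat (1\<^sub>m (sum_list (map fst js))) (0\<^sub>m (sum_list (map fst js)) (dim_col H))
       (0\<^sub>m (dim_row H) (sum_list (map fst js))) H"
    "P * G * Q = four_block_mat (jordan_matrix js) (0\<^sub>m (sum_list (map fst js)) (dim_col H))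
       (0\<^sub>m (dim_row H) (sum_list (map fst js))) N"
proof -
  define H where "H = diag_block_mat [jordan_matrix (map (\<lambda>l. (l, 0)) ns),
    diag_block_mat (map (\<lambda>z. 1\<^sub>m z @\<^sub>r 0\<^sub>m 1 z) zs), 0\<^sub>m h 0 :: complex mat]"
  define N where "N = diag_block_mat [1\<^sub>m (sum_list ns),
    diag_block_mat (map (\<lambda>z. 0\<^sub>m 1 z @\<^sub>r 1\<^sub>m z) zs), 0\<^sub>m h 0 :: complex mat]"
  have HN: "inert_pencil H N"
    unfolding H_def N_def
    by (intro inert_pencil_diag_block_mat)
      (simp add: inert_pencil_infinite_part inert_pencil_row_minimal_part inert_pencil_zero_rows
        del: One_nat_def)
  have "P * F * Q = four_block_mat (1\<^sub>m (sum_list (map fst js)))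
      (0\<^sub>m (dim_row (1\<^sub>m (sum_list (map fst js)) :: complex mat)) (dim_col H))
      (0\<^sub>m (dim_row H) (dim_col (1\<^sub>m (sum_list (map fst js)) :: complex mat))) H"
    "P * G * Q = four_block_mat (jordan_matrix js) (0\<^sub>m (dim_row (jordan_matrix js)) (dim_col N))
      (0\<^sub>m (dim_row N) (dim_col (jordan_matrix js))) N"
    using assms by (simp_all only: kronecker_form_def H_def N_def diag_block_mat.simps Let_def)
  moreover have "dim_row N = dim_row H" "dim_col N = dim_col H"
    using HN by (simp_all add: inert_pencil_def)
  ultimately show ?thesis
    by (intro that[OF HN]) simp_all
qed

lemma pow_mat_Suc_left:
  fixes A :: "'a::semiring_1 mat"
  assumes A: "A \<in> carrier_mat d d"
  shows "A ^\<^sub>m Suc k = A * A ^\<^sub>m k"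
proof (induction k)
  case 0
  show ?case using A by simp
next
  case (Suc k)
  then show ?case
    using A by (simp add: assoc_mult_mat[of A d d "A ^\<^sub>m k" d A d])
qed

text \<open>A sequence \<open>Y\<close> solves the equation iff \<open>Q\<^sup>-\<^sup>1 Y\<close> solves the one of the canonical form. There the
  inert part vanishes, which removes all columns of \<open>Q\<close> but those of \<open>Q\<^sub>p\<close>, and the remaining part is
  the orbit of an arbitrary vector under \<open>J\<close>.\<close>

lemma diff_solution_iff:
  assumes F: "F \<in> carrier_mat r m" and G: "G \<in> carrier_mat r m"
    and kcf: "kronecker_form F G P Q js ns zs h"
    and p: "p = sum_list (map fst js)" and J: "J = jordan_matrix js" and Qp: "Qp = first_cols p Q"
  shows "diff_solution F G k0 Y \<longleftrightarrow>
    (\<exists>C\<in>carrier_vec p. \<forall>k\<ge>k0. Y k = Qp * J ^\<^sub>m (k - k0) *\<^sub>v C)"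
proof -
  obtain H N where HN: "inert_pencil H N"
    and PF: "P * F * Q = four_block_mat (1\<^sub>m p) (0\<^sub>m p (dim_col H)) (0\<^sub>m (dim_row H) p) H"
    and PG: "P * G * Q = four_block_mat J (0\<^sub>m p (dim_col H)) (0\<^sub>m (dim_row H) p) N"
    using kronecker_form_split[OF kcf] unfolding p J by blast
  have P: "P \<in> carrier_mat r r" "invertible_mat P" and Q: "Q \<in> carrier_mat m m" "invertible_mat Q"
    using kcf F by (auto simp: kronecker_form_def)
  obtain P' where P': "P' \<in> carrier_mat r r" "P' * P = 1\<^sub>m r"
    using invertible_mat_obtain_inverse[OF P] by metis
  obtain Q' where Q': "Q' \<in> carrier_mat m m" "Q * Q' = 1\<^sub>m m"
    using invertible_mat_obtain_inverse[OF Q] by metis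
  have dN: "dim_row N = dim_row H" "dim_col N = dim_col H"
    using HN by (auto simp: inert_pencil_def)
  have Jc: "J \<in> carrier_mat p p"
    unfolding J p by (simp add: carrier_matI)
  have m: "m = p + dim_col H"
    using arg_cong[OF PF, of dim_col] Q by simp
  have Qpc: "Qp \<in> carrier_mat m p"
    using Q by (auto simp: Qp first_cols_def)
  have Qp_vec: "Qp *\<^sub>v v = Q *\<^sub>v (v @\<^sub>v 0\<^sub>v (dim_col H))" if v: "v \<in> carrier_vec p" for v
  proof (rule eq_vecI)
    show "dim_vec (Qp *\<^sub>v v) = dim_vec (Q *\<^sub>v (v @\<^sub>v 0\<^sub>v (dim_col H)))"
      using Q Qpc by simp
    fix i assume "i < dim_vec (Q *\<^sub>v (v @\<^sub>v 0\<^sub>v (dim_col H)))"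
    then have i: "i < m" using Q by simp
    have "row Q i = row Qp i @\<^sub>v vec (dim_col H) (\<lambda>j. Q $$ (i, p + j))"
      using Q i m by (intro eq_vecI) (auto simp: Qp first_cols_def)
    then have "row Q i \<bullet> (v @\<^sub>v 0\<^sub>v (dim_col H)) = row Qp i \<bullet> v
        + vec (dim_col H) (\<lambda>j. Q $$ (i, p + j)) \<bullet> 0\<^sub>v (dim_col H)"
      using scalar_prod_append[of "row Qp i" p "vec (dim_col H) (\<lambda>j. Q $$ (i, p + j))" "dim_col H" v
          "0\<^sub>v (dim_col H)"] v Qpc by (simp only: row_carrier_vec vec_carrier zero_carrier_vec) auto
    then show "(Qp *\<^sub>v v) $ i = (Q *\<^sub>v (v @\<^sub>v 0\<^sub>v (dim_col H))) $ i"
      using i Q Qpc by simp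
  qed
  have assoc: "P *\<^sub>v (M *\<^sub>v (Q *\<^sub>v z)) = P * M * Q *\<^sub>v z"
    if "M \<in> carrier_mat r m" "z \<in> carrier_vec m" for M z
    using that P Q by (simp add: assoc_mult_mat_vec[of _ r r _ m] assoc_mult_mat_vec[of _ r m _ m])
  have P_cancel: "x = y" if "P *\<^sub>v x = P *\<^sub>v y" "x \<in> carrier_vec r" "y \<in> carrier_vec r" for x y
    using arg_cong[OF that(1), of "\<lambda>v. P' *\<^sub>v v"] that(2,3) P' P
    by (simp add: assoc_mult_mat_vec[of _ r r _ r, symmetric])
  have orbit: "Qp * J ^\<^sub>m i *\<^sub>v C = Qp *\<^sub>v (J ^\<^sub>m i *\<^sub>v C)" if "C \<in> carrier_vec p" for i C
    using that Qpc Jc by (simp add: assoc_mult_mat_vec[of _ m p _ p])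
  have J_Suc: "J ^\<^sub>m Suc i *\<^sub>v C = J *\<^sub>v (J ^\<^sub>m i *\<^sub>v C)" if "C \<in> carrier_vec p" for i C
    unfolding pow_mat_Suc_left[OF Jc] by (rule assoc_mult_mat_vec[OF Jc pow_carrier_mat[OF Jc] that])
  show ?thesis
  proof
    assume sol: "diff_solution F G k0 Y"
    (* Time is shifted to start at 0, as the equation says nothing about Y before k0. *)
    define w where "w k = Q' *\<^sub>v Y (k0 + k)" for k
    have Yc: "Y (k0 + k) \<in> carrier_vec m" for k
      using sol F by (auto simp: diff_solution_def)
    have wc: "w k \<in> carrier_vec m" for k
      using Q' Yc by (auto simp: w_def)
    have Qw: "Q *\<^sub>v w k = Y (k0 + k)" for k
      using Q Q' Yc[of k] by (simp add: w_def assoc_mult_mat_vec[of _ m m _ m, symmetric])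
    have "P * F * Q *\<^sub>v w (Suc k) = P * G * Q *\<^sub>v w k" for k
      using sol by (simp flip: assoc[OF F wc] assoc[OF G wc] add: Qw diff_solution_def)
    then obtain x y where xy: "\<And>k. w k = x k @\<^sub>v y k"
      "\<And>k. x k \<in> carrier_vec p" "\<And>k. y k \<in> carrier_vec (dim_col H)"
      "\<And>k. 1\<^sub>m p *\<^sub>v x (Suc k) = J *\<^sub>v x k" "\<And>k. H *\<^sub>v y (Suc k) = N *\<^sub>v y k"
      using block_diag_solution_split[of J "1\<^sub>m p" N H w] Jc dN wc unfolding PF PG m by auto
    have y0: "y k = 0\<^sub>v (dim_col H)" for k
      using HN xy unfolding inert_pencil_def by blast
    have xk: "x k = J ^\<^sub>m k *\<^sub>v x 0" for k
    proof (induction k)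
      case 0
      show ?case using Jc xy(2) by simp
    next
      case (Suc k)
      show ?case
        using xy(4)[of k] xy(2) Suc J_Suc[of "x 0" k] by simp
    qed
    have "Y k = Qp * J ^\<^sub>m (k - k0) *\<^sub>v x 0" if "k \<ge> k0" for k
      using Qw[of "k - k0"] that by (simp add: orbit xy y0 Qp_vec flip: xk)
    then show "\<exists>C\<in>carrier_vec p. \<forall>k\<ge>k0. Y k = Qp * J ^\<^sub>m (k - k0) *\<^sub>v C"
      using xy(2) by blast
  next
    assume "\<exists>C\<in>carrier_vec p. \<forall>k\<ge>k0. Y k = Qp * J ^\<^sub>m (k - k0) *\<^sub>v C"
    then obtain C where C: "C \<in> carrier_vec p" and Y: "\<And>k. k \<ge> k0 \<Longrightarrow> Y k = Qp * J ^\<^sub>m (k - k0) *\<^sub>v C"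
      by blast
    show "diff_solution F G k0 Y"
      unfolding diff_solution_def
    proof (intro allI impI conjI)
      fix k assume k: "k \<ge> k0"
      define v where "v = J ^\<^sub>m (k - k0) *\<^sub>v C"
      have v: "v \<in> carrier_vec p" and Jv: "J *\<^sub>v v \<in> carrier_vec p"
        using mult_mat_vec_carrier[OF pow_carrier_mat[OF Jc] C] mult_mat_vec_carrier[OF Jc]
        by (simp_all add: v_def)
      have Yk: "Y k = Qp *\<^sub>v v"
        using k C by (simp add: Y orbit v_def)
      have YSk: "Y (Suc k) = Qp *\<^sub>v (J *\<^sub>v v)"
        using k C by (simp add: Y orbit v_def Suc_diff_le J_Suc del: pow_mat.simps)
      show "Y k \<in> carrier_vec (dim_col F)"
        using Yk Qpc v F by simp
      have vm: "v @\<^sub>v 0\<^sub>v (dim_col H) \<in> carrier_vec m" "(J *\<^sub>v v) @\<^sub>v 0\<^sub>v (dim_col H) \<in> carrier_vec m"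
        using v Jv m by auto
      have zero: "H *\<^sub>v 0\<^sub>v (dim_col H) = N *\<^sub>v 0\<^sub>v (dim_col H)"
        by (intro eq_vecI) (simp_all add: dN scalar_prod_def)
      have "P *\<^sub>v (F *\<^sub>v Y (Suc k)) = P *\<^sub>v (G *\<^sub>v Y k)"
        unfolding Yk YSk Qp_vec[OF v] Qp_vec[OF Jv] assoc[OF F vm(2)] assoc[OF G vm(1)] PF PG
        using v Jv Jc dN by (simp add: block_diag_mult_vec zero)
      then show "F *\<^sub>v Y (Suc k) = G *\<^sub>v Y k"
        unfolding Yk YSk
        by (rule P_cancel[OF _ mult_mat_vec_carrier[OF F mult_mat_vec_carrier[OF Qpc Jv]]
              mult_mat_vec_carrier[OF G mult_mat_vec_carrier[OF Qpc v]]])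
    qed
  qed
qed

section \<open>Optimal solutions of the boundary value problem\<close>

theorem theorem3p2:
  fixes F G A B P Q Jp Qp K :: "complex mat"
    and D :: "complex vec"
    and r m n p k0 kN h :: nat
    and js :: "(nat \<times> complex) list"
    and ns zs :: "nat list"
    and \<nu> :: "complex vec \<Rightarrow> real"
  assumes FG: "F \<in> carrier_mat r m" "G \<in> carrier_mat r m"
    and singular: "singular_pencil F G"
    and null_dim: "right_null_dim F G = 0"
    and AB: "A \<in> carrier_mat n m" "B \<in> carrier_mat n m"
    and D: "D \<in> carrier_vec n"
    and k: "k0 \<le> kN"
    and kcf: "kronecker_form F G P Q js ns zs h"
    and p: "p = sum_list (map fst js)"
    and Jp: "Jp = jordan_matrix js"
    and Qp: "Qp = first_cols p Q"
    and norm: "vec_norm_on p \<nu>" "induced_norm \<nu> \<nu> Jp < 1"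
    and K: "K = A * Qp + B * Qp * Jp ^\<^sub>m (kN - k0)"
    and nonconsistent: "\<not> bvp_consistent F G A B D k0 kN"
  shows
    "(p < n \<and> D \<notin> vec_space.col_space n K \<and> vec_space.rank n K = min n p \<longrightarrow>
       invertible_mat (mat_adjoint K * K) \<and>
       (let C = mat_inv (mat_adjoint K * K) * mat_adjoint K *\<^sub>v D;
            Y = (\<lambda>k. Qp * Jp ^\<^sub>m (k - k0) *\<^sub>v C)
        in least_squares_solution F G A B D k0 kN Y \<and>
           is_arg_min (\<lambda>C. (norm2 (D - K *\<^sub>v C))\<^sup>2) (\<lambda>C. C \<in> carrier_vec p) C)) \<and>
     (\<forall>E l \<theta>. D \<notin> vec_space.col_space n K \<and> vec_space.rank n K < min n p \<and>
       E \<in> carrier_mat l p \<and> invertible_mat (mat_adjoint K * K + mat_adjoint E * E) \<and>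
       induced_norm norm2 norm2 E = \<theta> \<and> 0 < \<theta> \<and> \<theta> < 1 \<longrightarrow>
       (let C = mat_inv (mat_adjoint K * K + mat_adjoint E * E) * mat_adjoint K *\<^sub>v D;
            Y = (\<lambda>k. Qp * Jp ^\<^sub>m (k - k0) *\<^sub>v C)
        in regularized_least_squares_solution F G A B D k0 kN Qp Jp E Y \<and>
           is_arg_min (\<lambda>C. (norm2 (D - K *\<^sub>v C))\<^sup>2 + (norm2 (E *\<^sub>v C))\<^sup>2)
             (\<lambda>C. C \<in> carrier_vec p) C))"
proof -
  note solutions = diff_solution_iff[OF FG kcf p Jp Qp, of k0]
  have Q: "Q \<in> carrier_mat m m"
    using kcf FG by (auto simp: kronecker_form_def)
  have Qpc: "Qp \<in> carrier_mat m p"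
    using Q by (auto simp: Qp first_cols_def)
  have Jc: "Jp \<in> carrier_mat p p"
    unfolding Jp p by (simp add: carrier_matI)
  note Jk = pow_carrier_mat[OF Jc]
  have BQJ: "B * Qp * Jp ^\<^sub>m (kN - k0) \<in> carrier_mat n p"
    by (rule mult_carrier_mat[OF mult_carrier_mat[OF AB(2) Qpc] Jk])
  have Kc: "K \<in> carrier_mat n p"
    unfolding K by (rule add_carrier_mat[OF BQJ])
  note K' = mat_adjoint_carrier[OF Kc]
  have residual: "boundary_residual A B D k0 kN Y = norm2 (D - K *\<^sub>v C)"
    if C: "C \<in> carrier_vec p" and Y: "\<And>k. k \<ge> k0 \<Longrightarrow> Y k = Qp * Jp ^\<^sub>m (k - k0) *\<^sub>v C" for Y C
  proof -
    let ?R = "Jp ^\<^sub>m (kN - k0)"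
    have "A *\<^sub>v Y k0 = A * Qp *\<^sub>v C"
      using Y[of k0] AB Qpc Jc C by (simp add: assoc_mult_mat_vec[of _ n m _ p])
    moreover have "B *\<^sub>v Y kN = B * Qp * ?R *\<^sub>v C"
      using Y[OF k] AB Qpc Jk C
      by (simp add: assoc_mult_mat_vec[of _ n m _ p] assoc_mult_mat[of _ n m _ p _ p])
    moreover have "K *\<^sub>v C = A * Qp *\<^sub>v C + B * Qp * ?R *\<^sub>v C"
      unfolding K
      by (rule add_mult_distrib_mat_vec[OF mult_carrier_mat[OF AB(1) Qpc] BQJ C])
    ultimately show ?thesis
      by (simp add: boundary_residual_def)
  qed
  show ?thesis
  proof (intro conjI impI allI)
    assume "p < n \<and> D \<notin> vec_space.col_space n K \<and> vec_space.rank n K = min n p"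
    then have inv: "invertible_mat (mat_adjoint K * K)"
      by (intro gram_matrix_invertible[OF Kc]) auto
    then show "invertible_mat (mat_adjoint K * K)" .
    define C where "C = mat_inv (mat_adjoint K * K) * mat_adjoint K *\<^sub>v D"
    define Y where "Y k = Qp * Jp ^\<^sub>m (k - k0) *\<^sub>v C" for k
    have C: "C \<in> carrier_vec p" and normal: "mat_adjoint K * K *\<^sub>v C = mat_adjoint K *\<^sub>v D"
      using mat_inv_solves[OF _ inv K' D] K' Kc by (auto simp: C_def)
    have min: "is_arg_min (\<lambda>C. (norm2 (D - K *\<^sub>v C))\<^sup>2) (\<lambda>C. C \<in> carrier_vec p) C"
      by (rule normal_equations_minimize_unpenalized[OF Kc D C normal])
    have residual_Y: "boundary_residual A B D k0 kN Y = norm2 (D - K *\<^sub>v C)"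
      by (rule residual[OF C]) (rule Y_def)
    have "diff_solution F G k0 Y"
      unfolding solutions using C Y_def by blast
    moreover have "(boundary_residual A B D k0 kN Y)\<^sup>2 \<le> (boundary_residual A B D k0 kN Z)\<^sup>2"
      if Z: "diff_solution F G k0 Z" for Z
    proof -
      obtain X where X: "X \<in> carrier_vec p" "\<And>k. k \<ge> k0 \<Longrightarrow> Z k = Qp * Jp ^\<^sub>m (k - k0) *\<^sub>v X"
        using Z unfolding solutions by blast
      have "boundary_residual A B D k0 kN Z = norm2 (D - K *\<^sub>v X)"
        by (rule residual[OF X(1)]) (rule X(2))
      then show ?thesis
        using min X(1) by (simp add: residual_Y is_arg_min_linorder)
    qed
    ultimately have "least_squares_solution F G A B D k0 kN Y"
      by (simp add: least_squares_solution_def is_arg_min_linorder)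
    with min show "let C = mat_inv (mat_adjoint K * K) * mat_adjoint K *\<^sub>v D;
            Y = (\<lambda>k. Qp * Jp ^\<^sub>m (k - k0) *\<^sub>v C)
        in least_squares_solution F G A B D k0 kN Y \<and>
           is_arg_min (\<lambda>C. (norm2 (D - K *\<^sub>v C))\<^sup>2) (\<lambda>C. C \<in> carrier_vec p) C"
      by (simp add: Let_def Y_def[abs_def] flip: C_def)
  next
    fix E l \<theta>
    assume "D \<notin> vec_space.col_space n K \<and> vec_space.rank n K < min n p \<and>
       E \<in> carrier_mat l p \<and> invertible_mat (mat_adjoint K * K + mat_adjoint E * E) \<and>
       induced_norm norm2 norm2 E = \<theta> \<and> 0 < \<theta> \<and> \<theta> < 1"
    then have E: "E \<in> carrier_mat l p"
      and inv: "invertible_mat (mat_adjoint K * K + mat_adjoint E * E)"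
      by auto
    define C where "C = mat_inv (mat_adjoint K * K + mat_adjoint E * E) * mat_adjoint K *\<^sub>v D"
    define Y where "Y k = Qp * Jp ^\<^sub>m (k - k0) *\<^sub>v C" for k
    have C: "C \<in> carrier_vec p"
      and normal: "(mat_adjoint K * K + mat_adjoint E * E) *\<^sub>v C = mat_adjoint K *\<^sub>v D"
      using mat_inv_solves[OF _ inv K' D] K' Kc E mat_adjoint_carrier[OF E] by (auto simp: C_def)
    have min: "is_arg_min (\<lambda>C. (norm2 (D - K *\<^sub>v C))\<^sup>2 + (norm2 (E *\<^sub>v C))\<^sup>2)
        (\<lambda>C. C \<in> carrier_vec p) C"
      by (rule normal_equations_minimize[OF Kc E D C normal])
    have residual_Y: "boundary_residual A B D k0 kN Y = norm2 (D - K *\<^sub>v C)"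
      by (rule residual[OF C]) (rule Y_def)
    have "(boundary_residual A B D k0 kN Y)\<^sup>2 + (norm2 (E *\<^sub>v C))\<^sup>2
        \<le> (boundary_residual A B D k0 kN Z)\<^sup>2 + (norm2 (E *\<^sub>v X))\<^sup>2"
      if X: "X \<in> carrier_vec p" "\<And>k. k \<ge> k0 \<Longrightarrow> Z k = Qp * Jp ^\<^sub>m (k - k0) *\<^sub>v X" for Z X
    proof -
      have "boundary_residual A B D k0 kN Z = norm2 (D - K *\<^sub>v X)"
        by (rule residual[OF X(1)]) (rule X(2))
      then show ?thesis
        using min X(1) by (simp add: residual_Y is_arg_min_linorder)
    qed
    moreover have "diff_solution F G k0 Y"
      unfolding solutions using C Y_def by blast
    ultimately have "regularized_least_squares_solution F G A B D k0 kN Qp Jp E Y"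
      unfolding regularized_least_squares_solution_def is_arg_min_linorder
      using C Qpc by (intro exI[of _ C]) (auto simp: Y_def)
    with min show "let C = mat_inv (mat_adjoint K * K + mat_adjoint E * E) * mat_adjoint K *\<^sub>v D;
            Y = (\<lambda>k. Qp * Jp ^\<^sub>m (k - k0) *\<^sub>v C)
        in regularized_least_squares_solution F G A B D k0 kN Qp Jp E Y \<and>
           is_arg_min (\<lambda>C. (norm2 (D - K *\<^sub>v C))\<^sup>2 + (norm2 (E *\<^sub>v C))\<^sup>2)
             (\<lambda>C. C \<in> carrier_vec p) C"
      by (simp add: Let_def Y_def[abs_def] flip: C_def)
  qed
qed

end
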